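(* Let $p>1$, let $k\ge 2$, let $L_1,\dots,L_k>0$, and let $f=(f_1,\dots,f_k)\in\mathbb{R}^k$ with $f_i\neq f_{i+1}$ for every $i=1,\dots,k-1$. For $\lambda>0$ let $u^\lambda=(u^\lambda_1,\dots,u^\lambda_k)\in\mathbb{R}^k$ be the unique minimizer over $\mathbb{R}^k$ of $$G_\lambda(v)=\sum_{i=2}^k |v_i-v_{i-1}|+\lambda\sum_{i=1}^k L_i|f_i-v_i|^p .$$ Then for each $i=1,\dots,k-1$ there exists $\lambda_i\in(0,\infty)$ such that $u^\lambda_i=u^\lambda_{i+1}$ for all $0<\lambda\le\lambda_i$, while $u^\lambda_i\neq u^\lambda_{i+1}$ for all $\lambda>\lambda_i$.
   Context: Since $p>1$, $G_\lambda$ has exactly one minimizer for each $\lambda>0$. The vector $f$ encodes a piecewise constant function on an interval with values $f_i$ on consecutive intervals of length $L_i$. *)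

theory Defs
  imports Complex_Main "HOL-Library.FuncSet"
begin

text \<open>Vectors in \<open>\<real>\<^sup>k\<close> are functions on the index set \<open>{1..k}\<close>, extended by \<^term>\<open>undefined\<close>
  outside it, so that two vectors are equal iff their \<open>k\<close> coordinates agree; in particular
  uniqueness of a minimizer is ordinary uniqueness of a function.\<close>

definition Rvec :: "nat \<Rightarrow> (nat \<Rightarrow> real) set" where
  "Rvec k = {1..k} \<rightarrow>\<^sub>E UNIV"

definition G :: "real \<Rightarrow> nat \<Rightarrow> (nat \<Rightarrow> real) \<Rightarrow> (nat \<Rightarrow> real) \<Rightarrow> real \<Rightarrow> (nat \<Rightarrow> real) \<Rightarrow> real" where
  "G p k L f lam v =
     (\<Sum>i=2..k. \<bar>v i - v (i - 1)\<bar>) + lam * (\<Sum>i=1..k. L i * \<bar>f i - v i\<bar> powr p)"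

text \<open>The description operator says nothing useful unless \<open>G\<close> has exactly one minimizer over
  \<open>\<real>\<^sup>k\<close>; for \<open>p > 1\<close>, \<open>lam > 0\<close> and positive \<open>L\<close> this is a fact to be proved, not an assumption.\<close>

definition minimizer :: "real \<Rightarrow> nat \<Rightarrow> (nat \<Rightarrow> real) \<Rightarrow> (nat \<Rightarrow> real) \<Rightarrow> real \<Rightarrow> nat \<Rightarrow> real" where
  "minimizer p k L f lam = (THE u. is_arg_min (G p k L f lam) (\<lambda>v. v \<in> Rvec k) u)"

end

theory Submission
  imports Defs "HOL-Analysis.Function_Topology"
begin

text \<open>
  The first-order conditions for a minimizer \<open>u\<close> are best read through their dual variable.
  With \<open>t = 1 / lam\<close> and \<open>g i\<close> the derivative of the \<open>i\<close>-th fidelity term, the partial sums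
  \<open>w j = g 1 (u 1) + \<dots> + g j (u j)\<close> vanish at \<open>0\<close> and \<open>k\<close>, stay in the tube \<open>[- t, t]\<close>, and touch
  the upper or lower wall of the tube wherever \<open>u\<close> jumps up or down (a taut string picture; see
  \<open>minimizer_has_calibration\<close>). The strict convexity of the fidelity
  appears as strict monotonicity of \<open>g i\<close>, on which the whole dependence on \<open>t\<close> rests.

  The key is a discrete maximum principle: for \<open>t \<le> s\<close> the two strings satisfy
  \<open>\<bar>w\<^sup>s - w\<^sup>t\<bar> \<le> s - t\<close> everywhere (\<open>calibration_diff_le\<close>). If \<open>u\<^sup>s\<close> jumps up at \<open>j\<close>, then
  \<open>w\<^sup>s j = s\<close>, so the difference \<open>w\<^sup>s - w\<^sup>t\<close> takes its largest possible value \<open>s - t\<close> at \<open>j\<close>. It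
  increases into \<open>j\<close> and decreases out of it, which by monotonicity of \<open>g\<close> means that
  \<open>u\<^sup>t j \<le> u\<^sup>s j < u\<^sup>s (j + 1) \<le> u\<^sup>t (j + 1)\<close>. Hence jumps persist when \<open>t\<close> decreases, that is, when
  \<open>lam\<close> increases (\<open>calibration_jump_mono\<close>).

  The same Lipschitz estimate makes \<open>g i (u\<^sup>t i)\<close> continuous in \<open>t\<close>, so the set of \<open>t\<close> without a
  jump at \<open>j\<close> contains its infimum \<open>c\<close>. The value \<open>t = 0\<close> fits into the family, with \<open>u = f\<close> and
  \<open>w = 0\<close>, and \<open>f\<close> does jump at \<open>j\<close>; therefore \<open>c > 0\<close>. Finally \<open>w\<close> is bounded independently
  of \<open>t\<close>, so it cannot touch the walls of a wide tube and all jumps vanish for large \<open>t\<close>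
  (\<open>minimizer_jump_imp_inverse_le\<close>). The threshold is \<open>1 / c\<close>.

  Uniqueness of the minimizer is the case \<open>s = t\<close> of the maximum principle; existence follows from
  compactness after clamping competitors to a box that contains the data.
\<close>

section \<open>Calibrations\<close>

text \<open>
  The Euler--Lagrange system of a total variation problem whose \<open>i\<close>-th fidelity term has derivative
  \<open>g i\<close>, with \<open>w\<close> as dual variable and \<open>t\<close> as the weight of the total variation. Putting the weight
  on the total variation makes \<open>t = 0\<close> a legitimate value.
\<close>

definition calibration ::
    "(nat \<Rightarrow> real \<Rightarrow> real) \<Rightarrow> nat \<Rightarrow> real \<Rightarrow> (nat \<Rightarrow> real) \<Rightarrow> (nat \<Rightarrow> real) \<Rightarrow> bool" where
  "calibration g k t u w \<longleftrightarrow>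
     w 0 = 0 \<and> w k = 0 \<and>
     (\<forall>i\<in>{1..k}. w i - w (i - 1) = g i (u i)) \<and>
     (\<forall>i\<in>{1..<k}. \<bar>w i\<bar> \<le> t \<and> (u i < u (i + 1) \<longrightarrow> w i = t) \<and> (u (i + 1) < u i \<longrightarrow> w i = - t))"

text \<open>Reflection exchanges upward and downward jumps, so only upward ones need to be treated.\<close>

lemma calibration_uminus:
  assumes "calibration g k t u w"
  shows "calibration (\<lambda>i x. - g i (- x)) k t (\<lambda>i. - u i) (\<lambda>i. - w i)"
  using assms unfolding calibration_def by auto

lemma strict_mono_reflect:
  fixes h :: "real \<Rightarrow> real"
  assumes "strict_mono h"
  shows "strict_mono (\<lambda>x. - h (- x))"
  using assms by (simp add: strict_mono_def)

text \<open>
  At an interior maximum of \<open>w' - w\<close> above \<open>s - t\<close>, the string \<open>w\<close> is off its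
  upper wall and \<open>w'\<close> off its lower wall, so \<open>u\<close> does not increase and \<open>u'\<close> does not decrease across
  that point; but the maximum makes the jump of \<open>u'\<close> smaller than that of \<open>u\<close>.
\<close>

lemma calibration_diff_le:
  fixes g :: "nat \<Rightarrow> real \<Rightarrow> real"
  assumes mono: "\<And>i. i \<in> {1..k} \<Longrightarrow> strict_mono (g i)"
    and t: "calibration g k t u w" and s: "calibration g k s u' w'"
    and "0 \<le> t" "t \<le> s" "j \<le> k"
  shows "w' j - w j \<le> s - t"
proof (rule ccontr)
  assume neg: "\<not> w' j - w j \<le> s - t"
  define d where "d i = w' i - w i" for i
  define m where "m = Max (d ` {0..k})"
  have le_m: "d i \<le> m" if "i \<le> k" for i
    unfolding m_def using that by (intro Max_ge) auto
  have "m \<in> d ` {0..k}"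
    unfolding m_def by (intro Max_in) auto
  then have ex: "\<exists>i. i \<le> k \<and> d i = m" by auto
  \<comment> \<open>The first maximum, so that the increment of \<open>d\<close> into it is strictly positive.\<close>
  define l where "l = (LEAST i. i \<le> k \<and> d i = m)"
  have l: "l \<le> k" "d l = m"
    using LeastI_ex[OF ex] unfolding l_def by auto
  have m_big: "m > s - t"
    using neg le_m[OF \<open>j \<le> k\<close>] unfolding d_def by linarith
  have "d 0 = 0" "d k = 0"
    using t s unfolding calibration_def d_def by auto
  moreover have "d l > 0"
    using l m_big \<open>t \<le> s\<close> by linarith
  ultimately have "l \<noteq> 0" "l \<noteq> k"
    by (metis less_irrefl)+
  then have lk: "1 \<le> l" "l < k" using l by auto
  have "d (l - 1) \<noteq> m"
    using not_less_Least[of "l - 1" "\<lambda>i. i \<le> k \<and> d i = m"] lk l unfolding l_def[symmetric] by auto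
  moreover have "d (l - 1) \<le> m"
    using lk by (intro le_m) simp
  ultimately have left: "d (l - 1) < d l"
    using l by linarith
  have right: "d (l + 1) \<le> d l"
    using le_m[of "l + 1"] lk l by auto
  have step: "d i - d (i - 1) = g i (u' i) - g i (u i)" if "i \<in> {1..k}" for i
  proof -
    have "w i - w (i - 1) = g i (u i)" "w' i - w' (i - 1) = g i (u' i)"
      using t s that unfolding calibration_def by blast+
    then show ?thesis unfolding d_def by linarith
  qed
  have "g l (u l) < g l (u' l)"
    using step[of l] left lk by simp
  then have ul: "u l < u' l"
    using strict_mono_less[OF mono[of l]] lk by auto
  have "g (l + 1) (u' (l + 1)) \<le> g (l + 1) (u (l + 1))"
    using step[of "l + 1"] right lk by simp
  then have ul1: "u' (l + 1) \<le> u (l + 1)"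
    using strict_mono_less_eq[OF mono[of "l + 1"]] lk by auto
  have "\<bar>w l\<bar> \<le> t" "\<bar>w' l\<bar> \<le> s"
    using t s lk unfolding calibration_def by auto
  moreover have "w' l > w l + (s - t)"
    using l m_big unfolding d_def by linarith
  ultimately have "w l < t" "w' l > - s"
    using \<open>t \<le> s\<close> by linarith+
  then have "\<not> u l < u (l + 1)" "\<not> u' (l + 1) < u' l"
    using t s lk unfolding calibration_def by force+
  then show False using ul ul1 by linarith
qed

lemma calibration_abs_diff_le:
  fixes g :: "nat \<Rightarrow> real \<Rightarrow> real"
  assumes mono: "\<And>i. i \<in> {1..k} \<Longrightarrow> strict_mono (g i)"
    and t: "calibration g k t u w" and s: "calibration g k s u' w'"
    and le: "0 \<le> t" "t \<le> s" "j \<le> k"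
  shows "\<bar>w' j - w j\<bar> \<le> s - t"
proof -
  have "w' j - w j \<le> s - t"
    by (rule calibration_diff_le[OF mono t s le])
  moreover have "- w' j - - w j \<le> s - t"
    by (rule calibration_diff_le[OF _ calibration_uminus[OF t] calibration_uminus[OF s] le])
       (intro strict_mono_reflect mono)
  ultimately show ?thesis by linarith
qed

lemma calibration_unique:
  fixes g :: "nat \<Rightarrow> real \<Rightarrow> real"
  assumes mono: "\<And>i. i \<in> {1..k} \<Longrightarrow> strict_mono (g i)"
    and "calibration g k t u w" "calibration g k t u' w'" "0 \<le> t" "i \<in> {1..k}"
  shows "u i = u' i"
proof -
  have eq: "w' j = w j" if "j \<le> k" for j
    using calibration_abs_diff_le[OF mono assms(2,3), of j] assms(4) that by simp
  have "g i (u i) = g i (u' i)"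
    using assms(2,3,5) eq[of i] eq[of "i - 1"] unfolding calibration_def
    by (metis atLeastAtMost_iff diff_le_self le_trans)
  then show ?thesis
    using strict_mono_eq[OF mono[OF assms(5)]] by simp
qed

text \<open>
  An upward jump of \<open>u'\<close> at \<open>j\<close> makes \<open>j\<close> a maximum point of \<open>w' - w\<close>; the increments of \<open>w' - w\<close> on
  both sides of \<open>j\<close> then show that the jump of \<open>u\<close> contains that of \<open>u'\<close>.
\<close>

lemma calibration_up_jump_mono:
  fixes g :: "nat \<Rightarrow> real \<Rightarrow> real"
  assumes mono: "\<And>i. i \<in> {1..k} \<Longrightarrow> strict_mono (g i)"
    and t: "calibration g k t u w" and s: "calibration g k s u' w'"
    and le: "0 \<le> t" "t \<le> s" and j: "j \<in> {1..<k}"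
    and jump: "u' j < u' (j + 1)"
  shows "u j < u (j + 1)"
proof -
  have D: "w' i - w i \<le> s - t" if "i \<le> k" for i
    by (rule calibration_diff_le[OF mono t s le that])
  have "w' j = s"
    using s j jump unfolding calibration_def by blast
  moreover have "\<bar>w j\<bar> \<le> t"
    using t j unfolding calibration_def by blast
  ultimately have top: "w' i - w i \<le> w' j - w j" if "i \<le> k" for i
    using D[OF that] by linarith
  have step: "w i - w (i - 1) = g i (u i)" "w' i - w' (i - 1) = g i (u' i)" if "i \<in> {1..k}" for i
    using t s that unfolding calibration_def by blast+
  have "j - 1 \<le> k" using j by auto
  then have "g j (u j) \<le> g j (u' j)"
    using step[of j] top[of "j - 1"] j by simp
  then have "u j \<le> u' j"
    using strict_mono_less_eq[OF mono[of j]] j by auto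
  moreover have "g (j + 1) (u' (j + 1)) \<le> g (j + 1) (u (j + 1))"
    using step[of "j + 1"] top[of "j + 1"] j by simp
  then have "u' (j + 1) \<le> u (j + 1)"
    using strict_mono_less_eq[OF mono[of "j + 1"]] j by auto
  ultimately show ?thesis using jump by linarith
qed

text \<open>
  As \<open>t\<close> grows to \<open>s\<close>, the numbers \<open>g i (u i)\<close> move by at most \<open>2 * (s - t)\<close>. Strict monotonicity of
  \<open>g j\<close> and \<open>g (j + 1)\<close> thus keeps the two values on their sides of the midpoint of the jump for a
  while.
\<close>

lemma calibration_up_jump_open:
  fixes g :: "nat \<Rightarrow> real \<Rightarrow> real"
  assumes mono: "\<And>i. i \<in> {1..k} \<Longrightarrow> strict_mono (g i)"
    and t: "calibration g k t u w" and "0 \<le> t" and j: "j \<in> {1..<k}"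
    and jump: "u j < u (j + 1)"
  obtains e where "e > 0"
    and "\<And>s u' w'. t \<le> s \<Longrightarrow> s < t + e \<Longrightarrow> calibration g k s u' w' \<Longrightarrow> u' j < u' (j + 1)"
proof -
  define m where "m = (u j + u (j + 1)) / 2"
  have m: "u j < m" "m < u (j + 1)" using jump unfolding m_def by auto
  have mj: "strict_mono (g j)" "strict_mono (g (j + 1))" using mono j by auto
  define e where "e = min (g j m - g j (u j)) (g (j + 1) (u (j + 1)) - g (j + 1) m) / 2"
  have "e > 0"
    using m mj unfolding e_def strict_mono_def by auto
  moreover have "u' j < u' (j + 1)"
    if s: "t \<le> s" "s < t + e" "calibration g k s u' w'" for s u' w'
  proof -
    have close: "\<bar>g i (u' i) - g i (u i)\<bar> < 2 * e" if i: "i \<in> {1..k}" for i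
    proof -
      have "\<bar>w' i - w i\<bar> \<le> s - t" "\<bar>w' (i - 1) - w (i - 1)\<bar> \<le> s - t"
        using calibration_abs_diff_le[OF mono t s(3) \<open>0 \<le> t\<close> s(1), of i]
          calibration_abs_diff_le[OF mono t s(3) \<open>0 \<le> t\<close> s(1), of "i - 1"] i by auto
      moreover have "w i - w (i - 1) = g i (u i)" "w' i - w' (i - 1) = g i (u' i)"
        using t s i unfolding calibration_def by auto
      ultimately show ?thesis using s(2) by linarith
    qed
    have "g j (u' j) < g j m"
      using close[of j] j unfolding e_def by (auto simp: min_def split: if_splits)
    moreover have "g (j + 1) m < g (j + 1) (u' (j + 1))"
      using close[of "j + 1"] j unfolding e_def by (auto simp: min_def split: if_splits)
    ultimately have "u' j < m" "m < u' (j + 1)"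
      using strict_mono_less[OF mj(1)] strict_mono_less[OF mj(2)] by auto
    then show ?thesis by simp
  qed
  ultimately show thesis by (rule that)
qed

lemma calibration_jump_mono:
  fixes g :: "nat \<Rightarrow> real \<Rightarrow> real"
  assumes mono: "\<And>i. i \<in> {1..k} \<Longrightarrow> strict_mono (g i)"
    and t: "calibration g k t u w" and s: "calibration g k s u' w'"
    and le: "0 \<le> t" "t \<le> s" and j: "j \<in> {1..<k}"
    and jump: "u' j \<noteq> u' (j + 1)"
  shows "u j \<noteq> u (j + 1)"
proof (cases "u' j < u' (j + 1)")
  case True
  then show ?thesis using calibration_up_jump_mono[OF mono t s le j] by simp
next
  case False
  then have "- u' j < - u' (j + 1)" using jump by simp
  then have "- u j < - u (j + 1)"
    by (intro calibration_up_jump_mono[OF _ calibration_uminus[OF t] calibration_uminus[OF s] le j])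
       (intro strict_mono_reflect mono)
  then show ?thesis by simp
qed

lemma calibration_jump_open:
  fixes g :: "nat \<Rightarrow> real \<Rightarrow> real"
  assumes mono: "\<And>i. i \<in> {1..k} \<Longrightarrow> strict_mono (g i)"
    and t: "calibration g k t u w" and "0 \<le> t" and j: "j \<in> {1..<k}"
    and jump: "u j \<noteq> u (j + 1)"
  obtains e where "e > 0"
    and "\<And>s u' w'. t \<le> s \<Longrightarrow> s < t + e \<Longrightarrow> calibration g k s u' w' \<Longrightarrow> u' j \<noteq> u' (j + 1)"
proof (cases "u j < u (j + 1)")
  case True
  from calibration_up_jump_open[OF mono t \<open>0 \<le> t\<close> j True]
  obtain e where e: "e > 0" "\<And>s u' w'. t \<le> s \<Longrightarrow> s < t + e \<Longrightarrow>
      calibration g k s u' w' \<Longrightarrow> u' j < u' (j + 1)"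
    by metis
  show thesis by (rule that[OF e(1) less_imp_neq[OF e(2)]])
next
  case False
  then have neg: "- u j < - u (j + 1)" using jump by simp
  have "strict_mono (\<lambda>x. - g i (- x))" if "i \<in> {1..k}" for i
    by (intro strict_mono_reflect mono that)
  from calibration_up_jump_open[OF this calibration_uminus[OF t] \<open>0 \<le> t\<close> j neg]
  obtain e where e: "e > 0" "\<And>s u' w'. t \<le> s \<Longrightarrow> s < t + e \<Longrightarrow>
      calibration (\<lambda>i x. - g i (- x)) k s u' w' \<Longrightarrow> u' j < u' (j + 1)"
    by metis
  have "u' j \<noteq> u' (j + 1)" if "t \<le> s" "s < t + e" "calibration g k s u' w'" for s u' w'
    using e(2)[OF that(1,2) calibration_uminus[OF that(3)]] by simp
  then show thesis by (rule that[OF e(1)])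
qed

text \<open>
  The set of \<open>t\<close> at which the jump has vanished is an up-set by \<open>calibration_jump_mono\<close> and contains
  its infimum by \<open>calibration_jump_open\<close>. That infimum is positive since \<open>0\<close> is not in the set.
\<close>

lemma calibration_merging_threshold:
  fixes g :: "nat \<Rightarrow> real \<Rightarrow> real"
  assumes mono: "\<And>i. i \<in> {1..k} \<Longrightarrow> strict_mono (g i)"
    and cal: "\<And>t. 0 \<le> t \<Longrightarrow> calibration g k t (U t) (W t)"
    and j: "j \<in> {1..<k}"
    and start: "U 0 j \<noteq> U 0 (j + 1)"
    and merged: "0 \<le> T" "U T j = U T (j + 1)"
  shows "\<exists>c>0. \<forall>t\<ge>0. U t j = U t (j + 1) \<longleftrightarrow> c \<le> t"
proof -
  define A where "A = {t. 0 \<le> t \<and> U t j = U t (j + 1)}"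
  define c where "c = Inf A"
  have bdd: "bdd_below A" unfolding A_def by (auto intro: bdd_belowI)
  have "T \<in> A" using merged unfolding A_def by simp
  then have "c \<ge> 0" unfolding c_def by (intro cInf_greatest) (auto simp: A_def)
  have Uc: "U c j = U c (j + 1)"
  proof (rule ccontr)
    assume "U c j \<noteq> U c (j + 1)"
    then obtain e where e: "e > 0" "\<And>s u' w'. c \<le> s \<Longrightarrow> s < c + e \<Longrightarrow>
        calibration g k s u' w' \<Longrightarrow> u' j \<noteq> u' (j + 1)"
      using calibration_jump_open[OF mono cal[OF \<open>c \<ge> 0\<close>] \<open>c \<ge> 0\<close> j] by metis
    obtain s where s: "s \<in> A" "s < c + e"
      using cInf_lessD[of A "c + e"] \<open>T \<in> A\<close> e(1) unfolding c_def by auto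
    have "c \<le> s" unfolding c_def by (rule cInf_lower[OF s(1) bdd])
    moreover have "0 \<le> s" "U s j = U s (j + 1)" using s(1) unfolding A_def by auto
    ultimately show False using e(2)[OF _ s(2) cal] by simp
  qed
  then have "c > 0" using start \<open>c \<ge> 0\<close> by (metis less_eq_real_def)
  moreover have "U t j = U t (j + 1) \<longleftrightarrow> c \<le> t" if "t \<ge> 0" for t
  proof
    assume "U t j = U t (j + 1)"
    then show "c \<le> t"
      unfolding c_def using that bdd by (intro cInf_lower) (auto simp: A_def)
  next
    assume "c \<le> t"
    then show "U t j = U t (j + 1)"
      using calibration_jump_mono[OF mono cal[OF \<open>c \<ge> 0\<close>] cal[OF that] \<open>c \<ge> 0\<close> \<open>c \<le> t\<close> j] Uc
      by auto
  qed
  ultimately show ?thesis by blast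
qed

section \<open>The power fidelity\<close>

lemma abs_powr_has_real_derivative:
  fixes p x :: real
  assumes "p > 1"
  shows "((\<lambda>x. \<bar>x\<bar> powr p) has_real_derivative p * (sgn x * \<bar>x\<bar> powr (p - 1))) (at x)"
proof -
  have pos: "((\<lambda>x. \<bar>x\<bar> powr p) has_real_derivative p * y powr (p - 1)) (at y)" if "y > 0" for y
  proof (rule has_field_derivative_transform_within_open)
    show "((\<lambda>x. x powr p) has_real_derivative p * y powr (p - 1)) (at y)"
      by (rule has_real_derivative_powr[OF that])
  qed (use that in \<open>auto intro: open_greaterThan[of 0]\<close>)
  consider "x > 0" | "x < 0" | "x = 0" by linarith
  then show ?thesis
  proof cases
    case 1
    then show ?thesis using pos[OF 1] by simp
  next
    case 2
    have "((\<lambda>x. \<bar>- x\<bar> powr p) has_real_derivative p * (- x) powr (p - 1) * (- 1)) (at x)"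
      using 2 by (intro DERIV_chain2[OF pos] derivative_eq_intros) auto
    then show ?thesis using 2 by simp
  next
    case 3
    have "((\<lambda>h. \<bar>h\<bar> powr (p - 1)) \<longlongrightarrow> 0) (at (0::real))"
      using assms by (intro tendsto_zero_powrI[where b = "p - 1"] tendsto_rabs_zero tendsto_intros) auto
    moreover have "\<bar>\<bar>h\<bar> powr p / h\<bar> = \<bar>h\<bar> powr (p - 1)" if "h \<noteq> 0" for h :: real
      using that by (simp add: powr_diff)
    then have "eventually (\<lambda>h. \<bar>h\<bar> powr (p - 1) = \<bar>\<bar>h\<bar> powr p / h\<bar>) (at (0::real))"
      by (auto simp: eventually_at_filter)
    ultimately have "((\<lambda>h. \<bar>\<bar>h\<bar> powr p / h\<bar>) \<longlongrightarrow> 0) (at (0::real))"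
      by (rule Lim_transform_eventually)
    then have "((\<lambda>h. \<bar>h\<bar> powr p / h) \<longlongrightarrow> 0) (at (0::real))"
      by (rule tendsto_rabs_zero_cancel)
    then show ?thesis using 3 by (simp add: has_field_derivative_iff)
  qed
qed

definition fidelity_slope :: "real \<Rightarrow> (nat \<Rightarrow> real) \<Rightarrow> (nat \<Rightarrow> real) \<Rightarrow> nat \<Rightarrow> real \<Rightarrow> real" where
  "fidelity_slope p L f i x = - (L i * (p * (sgn (f i - x) * \<bar>f i - x\<bar> powr (p - 1))))"

lemma fidelity_slope_is_derivative:
  assumes "p > 1"
  shows "((\<lambda>x. L i * \<bar>f i - x\<bar> powr p) has_real_derivative fidelity_slope p L f i x) (at x)"
proof -
  have "((\<lambda>x. \<bar>f i - x\<bar> powr p) has_real_derivative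
      p * (sgn (f i - x) * \<bar>f i - x\<bar> powr (p - 1)) * (0 - 1)) (at x)"
    by (intro DERIV_chain2[OF abs_powr_has_real_derivative[OF assms]] derivative_intros)
  from DERIV_cmult[OF this, of "L i"] show ?thesis by (simp add: fidelity_slope_def)
qed

lemma strict_mono_fidelity_slope:
  assumes "p > 1" "L i > 0"
  shows "strict_mono (fidelity_slope p L f i)"
proof -
  have *: "sgn x * \<bar>x\<bar> powr (p - 1) < sgn y * \<bar>y\<bar> powr (p - 1)" if "x < y" for x y :: real
  proof -
    consider "0 \<le> x" | "x < 0" "0 < y" | "y \<le> 0" by linarith
    then show ?thesis
    proof cases
      case 1
      then show ?thesis
        using that assms powr_less_mono2[of "p - 1" x y] by (cases "x = 0") auto
    next
      case 2
      then have "- (\<bar>x\<bar> powr (p - 1)) < 0" "0 < \<bar>y\<bar> powr (p - 1)" by auto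
      then show ?thesis using 2 by (simp del: powr_gt_zero)
    next
      case 3
      then show ?thesis
        using that assms powr_less_mono2[of "p - 1" "- y" "- x"] by (cases "y = 0") auto
    qed
  qed
  show ?thesis
    unfolding strict_mono_def fidelity_slope_def using assms by (auto intro!: mult_strict_left_mono *)
qed

text \<open>Trades the exponent \<open>p - 1\<close> for \<open>p\<close>, so that slopes are controlled by the energy.\<close>

lemma fidelity_slope_bound:
  assumes "p > 1" "L i > 0"
  shows "\<bar>fidelity_slope p L f i x\<bar> \<le> p * (L i + L i * \<bar>f i - x\<bar> powr p)"
proof -
  have *: "\<bar>f i - x\<bar> powr (p - 1) \<le> 1 + \<bar>f i - x\<bar> powr p"
  proof (cases "\<bar>f i - x\<bar> \<le> 1")
    case True
    then have "\<bar>f i - x\<bar> powr (p - 1) \<le> 1"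
      using assms by (intro powr_le1) auto
    then show ?thesis by (simp add: add_increasing2)
  next
    case False
    then have "\<bar>f i - x\<bar> powr (p - 1) \<le> \<bar>f i - x\<bar> powr p"
      by (intro powr_mono) auto
    then show ?thesis by simp
  qed
  have "\<bar>fidelity_slope p L f i x\<bar> = L i * p * (\<bar>sgn (f i - x)\<bar> * \<bar>f i - x\<bar> powr (p - 1))"
    using assms by (simp add: fidelity_slope_def abs_mult)
  also have "\<dots> \<le> L i * p * (1 + \<bar>f i - x\<bar> powr p)"
    using assms * by (intro mult_left_mono) (auto simp: abs_sgn_eq)
  finally show ?thesis by (simp add: algebra_simps)
qed

section \<open>Existence of a minimizer\<close>

lemma Rvec_extend: "(\<lambda>i. if i \<in> {1..k} then v i else undefined) \<in> Rvec k"
  unfolding Rvec_def by auto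

lemma G_has_minimizer:
  assumes "p > 1" "lam > 0" and L: "\<forall>i\<in>{1..k}. L i > 0"
  shows "\<exists>u. is_arg_min (G p k L f lam) (\<lambda>v. v \<in> Rvec k) u"
proof -
  define M where "M = (\<Sum>i=1..k. \<bar>f i\<bar>)"
  have M: "\<bar>f i\<bar> \<le> M" if "i \<in> {1..k}" for i
    unfolding M_def using that by (intro member_le_sum) auto
  have "M \<ge> 0" unfolding M_def by (intro sum_nonneg) auto
  define Box where "Box = Pi\<^sub>E UNIV (\<lambda>i. if i \<in> {1..k} then {- M..M} else {undefined :: real})"
  have "compact Box"
  proof -
    have "compactin (product_topology (\<lambda>i. euclidean) UNIV) Box"
      unfolding Box_def compactin_PiE by auto
    then show ?thesis by (simp add: euclidean_product_topology)
  qed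
  moreover have "(\<lambda>i. if i \<in> {1..k} then 0 else undefined) \<in> Box"
    using \<open>M \<ge> 0\<close> unfolding Box_def by auto
  then have "Box \<noteq> {}" by blast
  moreover have "continuous_on Box (G p k L f lam)"
  proof -
    have coord: "continuous_on Box (\<lambda>v. v i)" for i :: nat
      by (rule continuous_on_subset[OF continuous_on_product_coordinates]) auto
    have power: "continuous_on Box (\<lambda>v. \<bar>f i - v i\<bar> powr p)" for i
      using assms(1) by (intro continuous_on_powr' continuous_intros coord) auto
    show ?thesis
      unfolding G_def
      by (intro continuous_on_add continuous_on_mult continuous_on_sum continuous_on_rabs
          continuous_on_diff continuous_on_const coord power)
  qed
  ultimately obtain u where u: "u \<in> Box" "\<And>v. v \<in> Box \<Longrightarrow> G p k L f lam u \<le> G p k L f lam v"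
    using continuous_attains_inf by metis
  have Box_Rvec: "u \<in> Rvec k"
    using u(1) unfolding Box_def Rvec_def PiE_def extensional_def by (force split: if_splits)
  have "G p k L f lam u \<le> G p k L f lam v" if "v \<in> Rvec k" for v
  proof -
    \<comment> \<open>Clamping to \<open>{- M..M}\<close> is a contraction that fixes the data, so it does not increase \<open>G\<close>.\<close>
    define cl where "cl x = max (- M) (min M x)" for x :: real
    have cl: "\<bar>cl x - cl y\<bar> \<le> \<bar>x - y\<bar>" for x y
      unfolding cl_def by linarith
    have cl_fix: "\<bar>f i - cl x\<bar> \<le> \<bar>f i - x\<bar>" if "i \<in> {1..k}" for i x
      using M[OF that] unfolding cl_def by linarith
    define v' where "v' i = (if i \<in> {1..k} then cl (v i) else undefined)" for i
    have "v' \<in> Box"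
      unfolding Box_def v'_def cl_def using \<open>M \<ge> 0\<close> by auto
    then have "G p k L f lam u \<le> G p k L f lam v'" by (rule u(2))
    also have "\<dots> \<le> G p k L f lam v"
      unfolding G_def
    proof (intro add_mono mult_left_mono sum_mono)
      fix i assume "i \<in> {2..k}"
      then show "\<bar>v' i - v' (i - 1)\<bar> \<le> \<bar>v i - v (i - 1)\<bar>"
        using cl unfolding v'_def by auto
    next
      fix i assume i: "i \<in> {1..k}"
      then show "\<bar>f i - v' i\<bar> powr p \<le> \<bar>f i - v i\<bar> powr p"
        using cl_fix[OF i] assms(1) unfolding v'_def by (intro powr_mono2) auto
      show "0 \<le> L i" using L i by force
    qed (use assms in auto)
    finally show ?thesis .
  qed
  then show ?thesis
    using Box_Rvec unfolding is_arg_min_def by (meson not_less)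
qed

section \<open>Minimizers are calibrated\<close>

text \<open>
  Minimality at \<open>0\<close> says that \<open>- d\<close> is a subgradient of the absolute value at \<open>J\<close>.
\<close>

lemma abs_plus_smooth_min:
  fixes J :: real and D :: "real \<Rightarrow> real"
  assumes D: "(D has_real_derivative d) (at 0)"
    and min: "\<And>h. \<bar>J\<bar> + D 0 \<le> \<bar>J + h\<bar> + D h"
  shows "\<bar>d\<bar> \<le> 1 \<and> (0 < J \<longrightarrow> d = - 1) \<and> (J < 0 \<longrightarrow> d = 1)"
proof (cases "J = 0")
  case True
  have "\<not> d < - 1"
  proof
    assume "d < - 1"
    have "((\<lambda>h. h + D h) has_real_derivative 1 + d) (at 0)"
      by (intro derivative_intros D)
    from DERIV_neg_dec_right[OF this] \<open>d < - 1\<close> obtain e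
      where e: "e > 0" "\<And>h. 0 < h \<Longrightarrow> h < e \<Longrightarrow> D 0 > h + D h" by force
    have "e / 2 + D (e / 2) < D 0" using e by simp
    then show False using min[of "e / 2"] True e(1) by simp
  qed
  moreover have "\<not> d > 1"
  proof
    assume "d > 1"
    have "((\<lambda>h. - h + D h) has_real_derivative - 1 + d) (at 0)"
      by (intro derivative_intros D)
    from DERIV_pos_inc_left[OF this] \<open>d > 1\<close> obtain e
      where e: "e > 0" "\<And>h. 0 < h \<Longrightarrow> h < e \<Longrightarrow> h + D (- h) < D 0" by force
    have "e / 2 + D (- (e / 2)) < D 0" using e by simp
    then show False using min[of "- (e / 2)"] True e(1) by simp
  qed
  ultimately show ?thesis using True by auto
next
  case False
  have "((\<lambda>h. sgn J * h + D h) has_real_derivative sgn J * 1 + d) (at 0)"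
    by (intro DERIV_add DERIV_cmult DERIV_ident D)
  moreover have "\<forall>h. \<bar>0 - h\<bar> < \<bar>J\<bar> \<longrightarrow> sgn J * 0 + D 0 \<le> sgn J * h + D h"
  proof (intro allI impI)
    fix h assume "\<bar>0 - h\<bar> < \<bar>J\<bar>"
    then show "sgn J * 0 + D 0 \<le> sgn J * h + D h"
      using min[of h] by (cases "J > 0") (auto simp: sgn_if)
  qed
  ultimately have "sgn J * 1 + d = 0"
    using False by (intro DERIV_local_min[where d = "\<bar>J\<bar>"]) auto
  then show ?thesis using False by (auto simp: sgn_if split: if_splits)
qed

text \<open>
  Adding a constant \<open>h\<close> to all coordinates beyond \<open>j\<close> changes the total variation only in its term
  at \<open>j\<close>, and the derivative of the fidelity in \<open>h\<close> is a tail sum of the slopes. These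
  one-parameter variations yield all the conditions: \<open>j = 0\<close>, which leaves the total variation
  unchanged, gives \<open>w k = 0\<close>; then the tail sum beyond \<open>j\<close> equals \<open>- w j\<close>, and an interior \<open>j\<close>
  gives the conditions at \<open>j\<close>.
\<close>

lemma minimizer_has_calibration:
  assumes "p > 1" "lam > 0"
    and min: "is_arg_min (G p k L f lam) (\<lambda>v. v \<in> Rvec k) u"
  shows "calibration (fidelity_slope p L f) k (1 / lam) u (\<lambda>j. \<Sum>i=1..j. fidelity_slope p L f i (u i))"
    (is "calibration ?g k _ u ?w")
proof -
  have u: "u \<in> Rvec k"
    using min unfolding is_arg_min_def by simp
  have opt: "G p k L f lam u \<le> G p k L f lam v" if "v \<in> Rvec k" for v
    using min that unfolding is_arg_min_def by (auto simp: not_less)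
  define \<Phi> where "\<Phi> i x = L i * \<bar>f i - x\<bar> powr p" for i x
  define shift where "shift j h i = (if i \<in> {j + 1..k} then u i + h else u i)" for j i :: nat and h :: real
  define D where "D j h = lam * (\<Sum>i=1..k. \<Phi> i (shift j h i))" for j h
  define TV where "TV v = (\<Sum>i=2..k. \<bar>v i - v (i - 1)\<bar>)" for v :: "nat \<Rightarrow> real"
  have G: "G p k L f lam (shift j h) = TV (shift j h) + D j h" for j h
    unfolding G_def TV_def D_def \<Phi>_def by simp
  have shift0: "shift j 0 = u" for j
    unfolding shift_def by auto
  have opt_shift: "TV u + D j 0 \<le> TV (shift j h) + D j h" for j h
  proof -
    have "shift j h \<in> Rvec k"
      using u unfolding shift_def Rvec_def by (auto simp: PiE_def extensional_def)
    then show ?thesis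
      using opt[of "shift j h"] G[of j h] G[of j 0] shift0 by simp
  qed
  have D_deriv: "(D j has_real_derivative lam * (?w k - ?w j)) (at 0)" if "j \<le> k" for j
  proof -
    have "((\<lambda>h. \<Phi> i (shift j h i)) has_real_derivative (if i \<in> {j + 1..k} then ?g i (u i) else 0)) (at 0)"
      for i
    proof (cases "i \<in> {j + 1..k}")
      case True
      have "((\<lambda>h. \<Phi> i (u i + h)) has_real_derivative ?g i (u i) * (0 + 1)) (at 0)"
      proof (rule DERIV_chain2[where f = "\<Phi> i" and g = "\<lambda>h. u i + h"])
        show "(\<Phi> i has_real_derivative ?g i (u i)) (at (u i + 0))"
          using fidelity_slope_is_derivative[OF assms(1), of L i f "u i"] unfolding \<Phi>_def by simp
        show "((\<lambda>h. u i + h) has_real_derivative 0 + 1) (at 0)"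
          by (intro DERIV_add DERIV_const DERIV_ident)
      qed
      then show ?thesis using True unfolding shift_def by simp
    next
      case False
      then have "(\<lambda>h. \<Phi> i (shift j h i)) = (\<lambda>h. \<Phi> i (u i))"
        unfolding shift_def by auto
      then show ?thesis using False by (simp del: atLeastAtMost_iff)
    qed
    then have "(D j has_real_derivative
        lam * (\<Sum>i=1..k. if i \<in> {j + 1..k} then ?g i (u i) else 0)) (at 0)"
      unfolding D_def by (intro DERIV_cmult DERIV_sum)
    moreover have "(\<Sum>i=1..k. if i \<in> {j + 1..k} then ?g i (u i) else 0) = ?w k - ?w j"
    proof -
      have "{1..k} = {1..j} \<union> {j + 1..k}" using that by auto
      then have "?w k = ?w j + (\<Sum>i\<in>{j + 1..k}. ?g i (u i))"
        by (simp add: sum.union_disjoint)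
      moreover have "{1..k} \<inter> {j + 1..k} = {j + 1..k}" by auto
      ultimately show ?thesis
        by (simp add: sum.inter_restrict[symmetric] del: atLeastAtMost_iff)
    qed
    ultimately show ?thesis by simp
  qed
  have wk: "?w k = 0"
  proof -
    have "TV (shift 0 h) = TV u" for h
      unfolding TV_def shift_def by (intro sum.cong) auto
    then have "D 0 0 \<le> D 0 h" for h using opt_shift[of 0 h] by simp
    then have "lam * (?w k - ?w 0) = 0"
      by (intro DERIV_local_min[OF D_deriv, where d = 1]) auto
    then show ?thesis using assms(2) by simp
  qed
  have "\<bar>?w j\<bar> \<le> 1 / lam \<and> (u j < u (j + 1) \<longrightarrow> ?w j = 1 / lam) \<and> (u (j + 1) < u j \<longrightarrow> ?w j = - (1 / lam))"
    if j: "j \<in> {1..<k}" for j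
  proof -
    define J where "J = u (j + 1) - u j"
    have TV_split: "TV v = \<bar>v (j + 1) - v j\<bar> + (\<Sum>i\<in>{2..k} - {j + 1}. \<bar>v i - v (i - 1)\<bar>)" for v
      unfolding TV_def using j by (subst sum.remove[of _ "j + 1"]) auto
    have "TV (shift j h) - \<bar>J + h\<bar> = TV u - \<bar>J\<bar>" for h
    proof -
      have "(\<Sum>i\<in>{2..k} - {j + 1}. \<bar>shift j h i - shift j h (i - 1)\<bar>) =
            (\<Sum>i\<in>{2..k} - {j + 1}. \<bar>u i - u (i - 1)\<bar>)"
        unfolding shift_def by (intro sum.cong) auto
      moreover have "shift j h (j + 1) - shift j h j = J + h"
        unfolding shift_def J_def using j by auto
      ultimately show ?thesis
        using TV_split[of "shift j h"] TV_split[of u] unfolding J_def by simp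
    qed
    then have "\<bar>J\<bar> + D j 0 \<le> \<bar>J + h\<bar> + D j h" for h
      using opt_shift[of j h] by (smt (verit))
    from abs_plus_smooth_min[OF D_deriv this] j
    have "\<bar>lam * (?w k - ?w j)\<bar> \<le> 1 \<and> (0 < J \<longrightarrow> lam * (?w k - ?w j) = - 1) \<and>
        (J < 0 \<longrightarrow> lam * (?w k - ?w j) = 1)"
      by auto
    then show ?thesis
      using assms(2) unfolding wk J_def by (auto simp: abs_mult field_simps)
  qed
  moreover have "?w i - ?w (i - 1) = ?g i (u i)" if "i \<in> {1..k}" for i
    using that by (cases i) auto
  ultimately show ?thesis
    unfolding calibration_def using wk by auto
qed

text \<open>The limit of infinite \<open>lam\<close>, where the tube degenerates to a point.\<close>

lemma data_calibration: "calibration (fidelity_slope p L f) k 0 f (\<lambda>j. 0)"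
  by (simp add: calibration_def fidelity_slope_def)

text \<open>
  Comparing \<open>u\<close> with the zero vector bounds the fidelity of \<open>u\<close>, hence the partial sums of slopes,
  independently of \<open>lam\<close>. At a jump such a partial sum has modulus \<open>1 / lam\<close>.
\<close>

lemma minimizer_jump_imp_inverse_le:
  assumes "p > 1" "lam > 0" and L: "\<forall>i\<in>{1..k}. L i > 0"
    and min: "is_arg_min (G p k L f lam) (\<lambda>v. v \<in> Rvec k) u"
    and j: "j \<in> {1..<k}" and jump: "u j \<noteq> u (j + 1)"
  shows "1 / lam \<le> p * (\<Sum>i=1..k. L i + L i * \<bar>f i\<bar> powr p)"
proof -
  let ?g = "fidelity_slope p L f"
  have L': "L i > 0" if "i \<in> {1..k}" for i using L that by blast
  define z where "z i = (if i \<in> {1..k} then 0 else undefined :: real)" for i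
  have "z \<in> Rvec k" unfolding z_def by (rule Rvec_extend)
  then have "G p k L f lam u \<le> G p k L f lam z"
    using min unfolding is_arg_min_def by (auto simp: not_less)
  moreover have "G p k L f lam z = lam * (\<Sum>i=1..k. L i * \<bar>f i\<bar> powr p)"
  proof -
    have "(\<Sum>i=2..k. \<bar>z i - z (i - 1)\<bar>) = 0"
      unfolding z_def by (intro sum.neutral) auto
    moreover have "(\<Sum>i=1..k. L i * \<bar>f i - z i\<bar> powr p) = (\<Sum>i=1..k. L i * \<bar>f i\<bar> powr p)"
      unfolding z_def by (intro sum.cong) auto
    ultimately show ?thesis unfolding G_def by simp
  qed
  moreover have "lam * (\<Sum>i=1..k. L i * \<bar>f i - u i\<bar> powr p) \<le> G p k L f lam u"
    unfolding G_def by (simp add: sum_nonneg)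
  ultimately have "lam * (\<Sum>i=1..k. L i * \<bar>f i - u i\<bar> powr p) \<le> lam * (\<Sum>i=1..k. L i * \<bar>f i\<bar> powr p)"
    by linarith
  then have data: "(\<Sum>i=1..k. L i * \<bar>f i - u i\<bar> powr p) \<le> (\<Sum>i=1..k. L i * \<bar>f i\<bar> powr p)"
    using assms(2) by simp
  have "(\<Sum>i=1..j. ?g i (u i)) = 1 / lam \<or> (\<Sum>i=1..j. ?g i (u i)) = - (1 / lam)"
    using minimizer_has_calibration[OF assms(1,2) min] j linorder_less_linear[of "u j" "u (j + 1)"] jump
    unfolding calibration_def by blast
  then have "1 / lam = \<bar>\<Sum>i=1..j. ?g i (u i)\<bar>"
    using assms(2) by auto
  also have "\<dots> \<le> (\<Sum>i=1..j. \<bar>?g i (u i)\<bar>)" by (rule sum_abs)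
  also have "\<dots> \<le> (\<Sum>i=1..k. \<bar>?g i (u i)\<bar>)"
    using j by (intro sum_mono2) auto
  also have "\<dots> \<le> (\<Sum>i=1..k. p * (L i + L i * \<bar>f i - u i\<bar> powr p))"
    by (intro sum_mono fidelity_slope_bound assms(1) L')
  also have "\<dots> = p * ((\<Sum>i=1..k. L i) + (\<Sum>i=1..k. L i * \<bar>f i - u i\<bar> powr p))"
    by (simp add: sum_distrib_left[symmetric] sum.distrib)
  also have "\<dots> \<le> p * ((\<Sum>i=1..k. L i) + (\<Sum>i=1..k. L i * \<bar>f i\<bar> powr p))"
    using data assms(1) by (intro mult_left_mono add_left_mono) auto
  finally show ?thesis by (simp add: sum.distrib)
qed

section \<open>Uniqueness and the merging threshold\<close>

lemma minimizer_is_arg_min: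
  assumes "p > 1" "lam > 0" and L: "\<forall>i\<in>{1..k}. L i > 0"
  shows "is_arg_min (G p k L f lam) (\<lambda>v. v \<in> Rvec k) (minimizer p k L f lam)"
proof -
  let ?P = "is_arg_min (G p k L f lam) (\<lambda>v. v \<in> Rvec k)"
  have mono: "strict_mono (fidelity_slope p L f i)" if "i \<in> {1..k}" for i
    using strict_mono_fidelity_slope assms(1) L that by blast
  have unique: "u = v" if "?P u" "?P v" for u v
  proof (rule PiE_ext[where k = "{1..k}"])
    show "u \<in> {1..k} \<rightarrow>\<^sub>E UNIV" "v \<in> {1..k} \<rightarrow>\<^sub>E UNIV"
      using that unfolding is_arg_min_def Rvec_def by auto
    show "u i = v i" if "i \<in> {1..k}" for i
      using calibration_unique[OF mono minimizer_has_calibration[OF assms(1,2) \<open>?P u\<close>]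
          minimizer_has_calibration[OF assms(1,2) \<open>?P v\<close>]] assms(2) that by simp
  qed
  obtain u where "?P u"
    using G_has_minimizer[OF assms(1,2) L] by blast
  then show ?thesis
    unfolding minimizer_def by (rule theI[of ?P]) (rule unique[OF _ \<open>?P u\<close>])
qed

theorem theorem5p3:
  fixes p :: real and k :: nat and L f :: "nat \<Rightarrow> real" and u :: "real \<Rightarrow> nat \<Rightarrow> real"
  assumes "p > 1" and "k \<ge> 2"
    and "\<forall>i\<in>{1..k}. L i > 0"
    and "f \<in> Rvec k"
    and "\<forall>i\<in>{1..k - 1}. f i \<noteq> f (i + 1)"
    and "\<forall>lam>0. u lam = minimizer p k L f lam"
  shows "\<forall>i\<in>{1..k - 1}. \<exists>lam\<^sub>i>0.
           (\<forall>lam. 0 < lam \<and> lam \<le> lam\<^sub>i \<longrightarrow> u lam i = u lam (i + 1)) \<and>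
           (\<forall>lam>lam\<^sub>i. u lam i \<noteq> u lam (i + 1))"
proof
  fix i assume "i \<in> {1..k - 1}"
  then have i: "i \<in> {1..<k}" and fi: "f i \<noteq> f (i + 1)" using assms(5) by auto
  let ?g = "fidelity_slope p L f"
  have mono: "strict_mono (?g i)" if "i \<in> {1..k}" for i
    using strict_mono_fidelity_slope assms(1,3) that by blast
  have min: "is_arg_min (G p k L f lam) (\<lambda>v. v \<in> Rvec k) (u lam)" if "lam > 0" for lam
    using minimizer_is_arg_min[OF assms(1) that assms(3)] assms(6) that by simp
  \<comment> \<open>Reparametrize by \<open>t = 1 / lam\<close>, with the data at \<open>t = 0\<close>.\<close>
  define U where "U t = (if t = 0 then f else u (1 / t))" for t :: real
  define W where "W t = (if t = 0 then (\<lambda>j. 0) else (\<lambda>j. \<Sum>i=1..j. ?g i (U t i)))" for t :: real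
  have cal: "calibration ?g k t (U t) (W t)" if "0 \<le> t" for t
  proof (cases "t = 0")
    case True
    then show ?thesis using data_calibration unfolding U_def W_def by simp
  next
    case False
    then have "1 / t > 0" using that by simp
    from minimizer_has_calibration[OF assms(1) this min[OF this]] show ?thesis
      using False unfolding U_def W_def by simp
  qed
  \<comment> \<open>The added \<open>1\<close> pushes \<open>T\<close> strictly beyond the bound on \<open>1 / lam\<close> that a jump forces.\<close>
  define T where "T = \<bar>p * (\<Sum>i=1..k. L i + L i * \<bar>f i\<bar> powr p)\<bar> + 1"
  have "T > 0" unfolding T_def by linarith
  have "U T i = U T (i + 1)"
  proof (rule ccontr)
    assume "U T i \<noteq> U T (i + 1)"
    then have "u (1 / T) i \<noteq> u (1 / T) (i + 1)" using \<open>T > 0\<close> unfolding U_def by simp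
    from minimizer_jump_imp_inverse_le[OF assms(1) _ assms(3) min i this] \<open>T > 0\<close> show False
      unfolding T_def by simp
  qed
  moreover have "U 0 i \<noteq> U 0 (i + 1)" using fi unfolding U_def by simp
  ultimately obtain c where c: "c > 0" "\<And>t. t \<ge> 0 \<Longrightarrow> U t i = U t (i + 1) \<longleftrightarrow> c \<le> t"
    using calibration_merging_threshold[OF mono cal i, of T] \<open>T > 0\<close> by auto
  have eq: "u lam i = u lam (i + 1) \<longleftrightarrow> lam \<le> 1 / c" if "lam > 0" for lam
  proof -
    have "u lam i = u lam (i + 1) \<longleftrightarrow> c \<le> 1 / lam"
      using c(2)[of "1 / lam"] that unfolding U_def by simp
    then show ?thesis using c(1) that by (simp add: field_simps)
  qed
  show "\<exists>lam\<^sub>i>0. (\<forall>lam. 0 < lam \<and> lam \<le> lam\<^sub>i \<longrightarrow> u lam i = u lam (i + 1)) \<and>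
           (\<forall>lam>lam\<^sub>i. u lam i \<noteq> u lam (i + 1))"
  proof (intro exI[of _ "1 / c"] conjI allI impI)
    show "1 / c > 0" using c(1) by simp
    fix lam assume "0 < lam \<and> lam \<le> 1 / c"
    then show "u lam i = u lam (i + 1)" using eq by blast
  next
    fix lam assume "lam > 1 / c"
    moreover have "1 / c > 0" using c(1) by simp
    ultimately show "u lam i \<noteq> u lam (i + 1)" using eq[of lam] by linarith
  qed
qed

end
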